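(* Let $\mathbb{K}$ be an algebraically closed field, let $G=(V,A)$ be a connected simple directed graph on vertices $V=\{1,\dots,n\}$ with $n\geq 3$, assume that the characteristic of $\mathbb{K}$ does not divide $n$, and let $\omega\in\mathbb{K}$ be a primitive $n$-th root of unity. Then $$H_G=\bigcap_{C}H_{G,C},$$ where $C$ ranges over all Hamiltonian cycles of the graph $G$, $H_G$ is the Hamiltonian ideal of $G$ and $H_{G,C}$ is the cycle ideal of $C$, all in $\mathbb{K}[x_1,\dots,x_n]$ (an empty intersection being the whole ring).
   Context: Simple directed graph: no loops, no repeated arcs (both $(i,j)$ and $(j,i)$ may be present). $\delta^+(i)$ is the set of vertices $j$ with $(i,j)\in A$. The Hamiltonian ideal $H_G\subseteq\mathbb{K}[x_1,\dots,x_n]$ is generated by the polynomials $x_i^n-1$ and $\prod_{j\in\delta^+(i)}(\omega x_i-x_j)$ for $i\in V$ (an empty product is $1$). A cycle of length $k>2$ in $G$ is a set of arcs $C=\{(v_1,v_2),(v_2,v_3),\dots,(v_k,v_1)\}\subseteq A$ with $v_1,\dots,v_k$ distinct; it is Hamiltonian if $k=n$. $C$ is called doubly covered if consecutive vertices of $C$ are joined by arcs of $G$ in both directions; otherwise $C$ is called directed. Cycle ideal: for a cycle $C$ of length $k$ with vertices $v_1,\dots,v_k$ in cyclic order and $\omega$ a primitive $k$-th root of unity, $H_{G,C}=\langle g_1,\dots,g_k\rangle\subseteq\mathbb{K}[x_{v_1},\dots,x_{v_k}]$, where: - if $C$ is doubly covered, $g_i=x_{v_i}+\frac{\omega^{2+i}-\omega^{2-i}}{\omega^3-\omega}x_{v_{k-1}}+\frac{\omega^{1-i}-\omega^{3+i}}{\omega^3-\omega}x_{v_k}$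 for $1\le i\le k-2$, $g_{k-1}=(x_{v_{k-1}}-\omega x_{v_k})(x_{v_{k-1}}-\omega^{-1}x_{v_k})$, and $g_k=x_{v_k}^k-1$; - if $C$ is directed, $g_i=x_{v_{k-i}}-\omega^{k-i}x_{v_k}$ for $1\le i\le k-1$, and $g_k=x_{v_k}^k-1$. For a Hamiltonian cycle, $k=n$ and the polynomial ring is $\mathbb{K}[x_1,\dots,x_n]$. *)

theory Defs
  imports
    "HOL-Library.Poly_Mapping"
    "HOL-Computational_Algebra.Polynomial"
    "HOL-Algebra.Ideal"
    "Graph_Theory.Graph_Theory"
begin

text \<open>
  A multivariate polynomial is a finitely supported map from monomials to coefficients, and a
  monomial is a finitely supported map from variables to exponents; the product on
  \<open>\<Rightarrow>\<^sub>0\<close> is convolution.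
\<close>
type_synonym ('v, 'k) mpoly = "('v \<Rightarrow>\<^sub>0 nat) \<Rightarrow>\<^sub>0 'k"

definition PVar :: "'v \<Rightarrow> ('v, 'k::field) mpoly" where
  "PVar i = Poly_Mapping.single (Poly_Mapping.single i 1) 1"

definition PConst :: "'k::field \<Rightarrow> ('v, 'k) mpoly" where
  "PConst c = Poly_Mapping.single 0 c"

text \<open>The polynomial ring over \<open>'k\<close> in the variables \<open>x\<^sub>v\<close>, \<open>v \<in> V\<close>.\<close>
definition mpoly_ring :: "'v set \<Rightarrow> ('v, 'k::field) mpoly ring" where
  "mpoly_ring V =
     \<lparr>carrier = {p. \<forall>m \<in> Poly_Mapping.keys p. Poly_Mapping.keys m \<subseteq> V},
      mult = (*), one = 1, zero = 0, add = (+)\<rparr>"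

definition primitive_root_of_unity :: "nat \<Rightarrow> 'k::field \<Rightarrow> bool" where
  "primitive_root_of_unity n \<omega> \<longleftrightarrow> n > 0 \<and> \<omega> ^ n = 1 \<and> (\<forall>m. 0 < m \<and> m < n \<longrightarrow> \<omega> ^ m \<noteq> 1)"

definition out_nbrs :: "'v pair_pre_digraph \<Rightarrow> 'v \<Rightarrow> 'v set" where
  "out_nbrs G i = {j. (i, j) \<in> parcs G}"

definition hamiltonian_ideal :: "'v pair_pre_digraph \<Rightarrow> 'k::field \<Rightarrow> ('v, 'k) mpoly set" where
  "hamiltonian_ideal G \<omega> =
     Idl\<^bsub>mpoly_ring (pverts G)\<^esub>
       ((\<lambda>i. PVar i ^ card (pverts G) - 1) ` pverts G \<union>
        (\<lambda>i. \<Prod>j \<in> out_nbrs G i. PConst \<omega> * PVar i - PVar j) ` pverts G)"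

definition cycle_arcs :: "'v list \<Rightarrow> ('v \<times> 'v) set" where
  "cycle_arcs vs = {(vs ! i, vs ! (Suc i mod length vs)) | i. i < length vs}"

text \<open>\<open>vs = [v\<^sub>1, \<dots>, v\<^sub>k]\<close> lists the vertices of the cycle \<open>C\<close> of \<open>G\<close> in cyclic order,
  from an arbitrary starting vertex.\<close>
definition cycle_listing :: "'v pair_pre_digraph \<Rightarrow> ('v \<times> 'v) set \<Rightarrow> 'v list \<Rightarrow> bool" where
  "cycle_listing G C vs \<longleftrightarrow>
     length vs > 2 \<and> distinct vs \<and> C = cycle_arcs vs \<and> C \<subseteq> parcs G"

definition hamiltonian_cycles :: "'v pair_pre_digraph \<Rightarrow> ('v \<times> 'v) set set" where
  "hamiltonian_cycles G = {C. \<exists>vs. cycle_listing G C vs \<and> length vs = card (pverts G)}"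

definition doubly_covered :: "'v pair_pre_digraph \<Rightarrow> ('v \<times> 'v) set \<Rightarrow> bool" where
  "doubly_covered G C \<longleftrightarrow> (\<forall>(u, v) \<in> C. (u, v) \<in> parcs G \<and> (v, u) \<in> parcs G)"

definition doubly_covered_gens :: "'k::field \<Rightarrow> 'v list \<Rightarrow> ('v, 'k) mpoly set" where
  "doubly_covered_gens \<omega> vs =
     (let k = length vs; x = (\<lambda>i. PVar (vs ! (i - 1))) in
      {x i + PConst ((\<omega> powi (2 + int i) - \<omega> powi (2 - int i)) / (\<omega> ^ 3 - \<omega>)) * x (k - 1)
           + PConst ((\<omega> powi (1 - int i) - \<omega> powi (3 + int i)) / (\<omega> ^ 3 - \<omega>)) * x k
         | i. 1 \<le> i \<and> i \<le> k - 2} \<union>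
      {(x (k - 1) - PConst \<omega> * x k) * (x (k - 1) - PConst (inverse \<omega>) * x k), x k ^ k - 1})"

definition directed_gens :: "'k::field \<Rightarrow> 'v list \<Rightarrow> ('v, 'k) mpoly set" where
  "directed_gens \<omega> vs =
     (let k = length vs; x = (\<lambda>i. PVar (vs ! (i - 1))) in
      {x (k - i) - PConst (\<omega> ^ (k - i)) * x k | i. 1 \<le> i \<and> i \<le> k - 1} \<union> {x k ^ k - 1})"

text \<open>
  The generators of the cycle ideal are written in terms of a listing \<open>v\<^sub>1, \<dots>, v\<^sub>k\<close> of the
  vertices of the cycle in cyclic order, so the listing is the argument here. The parameter
  \<open>\<omega>\<close> is meant to be a primitive \<open>k\<close>-th root of unity.
\<close>
definition cycle_ideal :: "'v pair_pre_digraph \<Rightarrow> 'k::field \<Rightarrow> 'v list \<Rightarrow> ('v, 'k) mpoly set" where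
  "cycle_ideal G \<omega> vs =
     Idl\<^bsub>mpoly_ring (set vs)\<^esub>
       (if doubly_covered G (cycle_arcs vs) then doubly_covered_gens \<omega> vs
        else directed_gens \<omega> vs)"

end

(*
  Every ideal I of K[x_v : v \<in> V] containing all x_v^n - 1 is determined by its zeros on the grid
  of n-th roots of unity: the Lagrange idempotents L_a of the grid sum to 1 and satisfy
  f L_a = f(a) L_a modulo I, so f is in I as soon as f vanishes at the zeros of I, because L_a is
  in I whenever a is not a zero. Radicality is therefore elementary and no Nullstellensatz is needed.
  For the cycle ideals the same argument works with the (at most 2n) idempotents of their zeros
  x_{v_i} = \<zeta>^i c, where c^n = 1 and \<zeta> = \<omega>, or also \<zeta> = 1/\<omega> if the cycle is doubly covered.

  At a zero of H_G every vertex with value u has an out-neighbour with value \<omega> u. Following such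
  arcs meets n different values, hence all n vertices, and closes up to a Hamiltonian cycle; so the
  zeros of H_G are those of the cycle ideals. (The two families of zeros of a doubly covered cycle
  belong to its two orientations.)
*)
theory Submission
  imports Defs
begin

section \<open>Polynomial rings and evaluation\<close>

definition monom_eval :: "('v \<Rightarrow> 'k::field) \<Rightarrow> ('v \<Rightarrow>\<^sub>0 nat) \<Rightarrow> 'k" where
  "monom_eval a m = (\<Prod>v\<in>Poly_Mapping.keys m. a v ^ Poly_Mapping.lookup m v)"

definition peval :: "('v \<Rightarrow> 'k::field) \<Rightarrow> ('v, 'k) mpoly \<Rightarrow> 'k" where
  "peval a p = (\<Sum>m\<in>Poly_Mapping.keys p. Poly_Mapping.lookup p m * monom_eval a m)"

text \<open>Exponents outside the support are 0 and contribute factors 1. Two monomials with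
  different supports can thus be evaluated over one common index set.\<close>

lemma monom_eval_superset:
  assumes "finite S" "Poly_Mapping.keys m \<subseteq> S"
  shows "monom_eval a m = (\<Prod>v\<in>S. a v ^ Poly_Mapping.lookup m v)"
  unfolding monom_eval_def using assms
  by (intro prod.mono_neutral_left) (auto simp: in_keys_iff)

lemma monom_eval_add: "monom_eval a (m + m') = monom_eval a m * monom_eval a m'"
proof -
  let ?S = "Poly_Mapping.keys m \<union> Poly_Mapping.keys m'"
  have "monom_eval a (m + m') = (\<Prod>v\<in>?S. a v ^ Poly_Mapping.lookup (m + m') v)"
    using keys_add[of m m'] by (intro monom_eval_superset) auto
  also have "\<dots> = (\<Prod>v\<in>?S. a v ^ Poly_Mapping.lookup m v) * (\<Prod>v\<in>?S. a v ^ Poly_Mapping.lookup m' v)"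
    by (simp add: lookup_add power_add prod.distrib)
  also have "\<dots> = monom_eval a m * monom_eval a m'"
    by (simp add: monom_eval_superset[of ?S])
  finally show ?thesis .
qed

lemma peval_superset:
  assumes "finite S" "Poly_Mapping.keys p \<subseteq> S"
  shows "peval a p = (\<Sum>m\<in>S. Poly_Mapping.lookup p m * monom_eval a m)"
  unfolding peval_def using assms
  by (intro sum.mono_neutral_left) (auto simp: in_keys_iff)

lemma peval_add [simp]: "peval a (p + q) = peval a p + peval a q"
proof -
  let ?S = "Poly_Mapping.keys p \<union> Poly_Mapping.keys q"
  have "peval a (p + q) = (\<Sum>m\<in>?S. Poly_Mapping.lookup (p + q) m * monom_eval a m)"
    using keys_add[of p q] by (intro peval_superset) auto
  also have "\<dots> = peval a p + peval a q"
    by (simp add: peval_superset[of ?S] lookup_add distrib_right sum.distrib)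
  finally show ?thesis .
qed

lemma peval_0 [simp]: "peval a 0 = 0"
  by (simp add: peval_def)

lemma peval_sum: "peval a (\<Sum>x\<in>A. f x) = (\<Sum>x\<in>A. peval a (f x))"
  by (induction A rule: infinite_finite_induct) simp_all

lemma peval_single [simp]: "peval a (Poly_Mapping.single m c) = c * monom_eval a m"
  by (simp add: peval_def)

lemma poly_mapping_sum_singles:
  fixes p :: "'a \<Rightarrow>\<^sub>0 'b::comm_monoid_add"
  shows "p = (\<Sum>m\<in>Poly_Mapping.keys p. Poly_Mapping.single m (Poly_Mapping.lookup p m))"
proof (rule poly_mapping_eqI)
  fix k
  have "(\<Sum>m\<in>Poly_Mapping.keys p. Poly_Mapping.lookup (Poly_Mapping.single m (Poly_Mapping.lookup p m)) k)
    = (\<Sum>m\<in>Poly_Mapping.keys p. if m = k then Poly_Mapping.lookup p m else 0)"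
    by (intro sum.cong refl) (auto simp: lookup_single)
  also have "\<dots> = Poly_Mapping.lookup p k"
    by (simp add: in_keys_iff)
  finally show "Poly_Mapping.lookup p k = Poly_Mapping.lookup
    (\<Sum>m\<in>Poly_Mapping.keys p. Poly_Mapping.single m (Poly_Mapping.lookup p m)) k"
    by (simp add: lookup_sum)
qed

lemma peval_mult [simp]: "peval a (p * q) = peval a p * peval a q"
proof -
  let ?s = "\<lambda>p m. Poly_Mapping.single m (Poly_Mapping.lookup p m)"
  have "p * q = (\<Sum>m\<in>Poly_Mapping.keys p. ?s p m) * (\<Sum>m\<in>Poly_Mapping.keys q. ?s q m)"
    by (simp flip: poly_mapping_sum_singles)
  then have "peval a (p * q) = (\<Sum>m\<in>Poly_Mapping.keys p. \<Sum>m'\<in>Poly_Mapping.keys q.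
      Poly_Mapping.lookup p m * monom_eval a m * (Poly_Mapping.lookup q m' * monom_eval a m'))"
    by (simp add: sum_product peval_sum mult_single monom_eval_add ac_simps)
  then show ?thesis
    by (simp add: peval_def sum_product)
qed

lemma peval_PConst [simp]: "peval a (PConst c) = c"
  by (simp add: PConst_def monom_eval_def)

lemma peval_PVar [simp]: "peval a (PVar v) = a v"
  by (simp add: PVar_def monom_eval_def)

lemma PConst_0 [simp]: "PConst 0 = 0"
  by (simp add: PConst_def)

lemma PConst_1 [simp]: "PConst 1 = 1"
  by (simp add: PConst_def)

lemma PConst_add: "PConst (c + d) = PConst c + PConst d"
  by (simp add: PConst_def single_add)

lemma PConst_mult: "PConst (c * d) = PConst c * PConst d"
  by (simp add: PConst_def mult_single)

lemma PConst_uminus: "PConst (- c) = - PConst c"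
  by (simp add: PConst_def single_uminus)

lemma PConst_diff: "PConst (c - d) = PConst c - PConst d"
  by (simp add: PConst_def single_diff)

lemma PConst_power: "PConst (c ^ k) = PConst c ^ k"
  by (induction k) (simp_all add: PConst_mult)

lemma PConst_sum: "PConst (\<Sum>x\<in>A. f x) = (\<Sum>x\<in>A. PConst (f x))"
  by (induction A rule: infinite_finite_induct) (simp_all add: PConst_add)

lemma peval_1 [simp]: "peval a 1 = 1"
  using peval_PConst[of a 1] by simp

lemma peval_uminus [simp]: "peval a (- p) = - peval a p"
  using peval_add[of a p "- p"] by (simp add: add_eq_0_iff)

lemma peval_diff [simp]: "peval a (p - q) = peval a p - peval a q"
  using peval_add[of a p "- q"] by simp

lemma peval_power [simp]: "peval a (p ^ k) = peval a p ^ k"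
  by (induction k) simp_all

lemma peval_prod: "peval a (\<Prod>x\<in>A. f x) = (\<Prod>x\<in>A. peval a (f x))"
  by (induction A rule: infinite_finite_induct) simp_all

section \<open>The polynomial ring in the variables of a vertex set\<close>

lemma mpoly_ring_simps [simp]:
  "mult (mpoly_ring V) = (*)" "one (mpoly_ring V) = 1"
  "zero (mpoly_ring V) = 0" "add (mpoly_ring V) = (+)"
  by (simp_all add: mpoly_ring_def)

lemma mem_mpoly_ring:
  "p \<in> carrier (mpoly_ring V) \<longleftrightarrow> (\<forall>m\<in>Poly_Mapping.keys p. Poly_Mapping.keys m \<subseteq> V)"
  by (simp add: mpoly_ring_def)

lemma zero_in_mpoly_ring [simp]: "0 \<in> carrier (mpoly_ring V)"
  by (simp add: mem_mpoly_ring)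

lemma PConst_in_mpoly_ring [simp]: "PConst c \<in> carrier (mpoly_ring V)"
  by (simp add: mem_mpoly_ring PConst_def)

lemma one_in_mpoly_ring [simp]: "1 \<in> carrier (mpoly_ring V)"
  by (simp add: mem_mpoly_ring)

lemma PVar_in_mpoly_ring [simp]: "v \<in> V \<Longrightarrow> PVar v \<in> carrier (mpoly_ring V)"
  by (simp add: mem_mpoly_ring PVar_def)

lemma add_in_mpoly_ring [simp]:
  "p \<in> carrier (mpoly_ring V) \<Longrightarrow> q \<in> carrier (mpoly_ring V) \<Longrightarrow> p + q \<in> carrier (mpoly_ring V)"
  using keys_add[of p q] by (auto simp: mem_mpoly_ring)

lemma mult_in_mpoly_ring [simp]:
  assumes "p \<in> carrier (mpoly_ring V)" "q \<in> carrier (mpoly_ring V)"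
  shows "p * q \<in> carrier (mpoly_ring V)"
  unfolding mem_mpoly_ring
proof
  fix m assume "m \<in> Poly_Mapping.keys (p * q)"
  then obtain m1 m2 where "m = m1 + m2" "m1 \<in> Poly_Mapping.keys p" "m2 \<in> Poly_Mapping.keys q"
    using keys_mult[of p q] by blast
  then show "Poly_Mapping.keys m \<subseteq> V"
    using assms keys_add[of m1 m2] unfolding mem_mpoly_ring by blast
qed

lemma uminus_in_mpoly_ring [simp]:
  assumes "p \<in> carrier (mpoly_ring V)"
  shows "- p \<in> carrier (mpoly_ring V)"
proof -
  have "- p = PConst (-1) * p"
    by (simp add: PConst_uminus)
  then show ?thesis
    using assms by (simp del: mult_minus_left)
qed

lemma diff_in_mpoly_ring [simp]:
  "p \<in> carrier (mpoly_ring V) \<Longrightarrow> q \<in> carrier (mpoly_ring V) \<Longrightarrow> p - q \<in> carrier (mpoly_ring V)"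
  using add_in_mpoly_ring[of p V "- q"] by simp

lemma power_in_mpoly_ring [simp]:
  "p \<in> carrier (mpoly_ring V) \<Longrightarrow> p ^ k \<in> carrier (mpoly_ring V)"
  by (induction k) simp_all

lemma sum_in_mpoly_ring:
  "(\<And>x. x \<in> A \<Longrightarrow> f x \<in> carrier (mpoly_ring V)) \<Longrightarrow> (\<Sum>x\<in>A. f x) \<in> carrier (mpoly_ring V)"
  by (induction A rule: infinite_finite_induct) simp_all

lemma prod_in_mpoly_ring:
  "(\<And>x. x \<in> A \<Longrightarrow> f x \<in> carrier (mpoly_ring V)) \<Longrightarrow> (\<Prod>x\<in>A. f x) \<in> carrier (mpoly_ring V)"
  by (induction A rule: infinite_finite_induct) simp_all

lemma mpoly_ring_mono: "V \<subseteq> W \<Longrightarrow> carrier (mpoly_ring V) \<subseteq> carrier (mpoly_ring W)"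
  unfolding mem_mpoly_ring subset_iff by blast

lemma cring_mpoly_ring: "cring (mpoly_ring V)"
proof (rule cringI)
  show "abelian_group (mpoly_ring V)"
  proof (rule abelian_groupI)
    fix p assume "p \<in> carrier (mpoly_ring V)"
    then show "\<exists>q\<in>carrier (mpoly_ring V). q \<oplus>\<^bsub>mpoly_ring V\<^esub> p = \<zero>\<^bsub>mpoly_ring V\<^esub>"
      by (intro bexI[of _ "- p"]) simp_all
  qed (simp_all add: ac_simps)
  show "comm_monoid (mpoly_ring V)"
    by (rule comm_monoidI) (simp_all add: ac_simps)
qed (simp_all add: algebra_simps)

lemma PVar_power: "PVar v ^ k = Poly_Mapping.single (Poly_Mapping.single v k) 1"
  by (induction k) (simp_all add: PVar_def mult_single flip: single_add)

lemma single_sum_1: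
  "Poly_Mapping.single (\<Sum>x\<in>A. f x) (1::'k::field) = (\<Prod>x\<in>A. Poly_Mapping.single (f x) 1)"
proof (induction A rule: infinite_finite_induct)
  case (insert x A)
  have "Poly_Mapping.single (f x + sum f A) (1::'k)
      = Poly_Mapping.single (f x) 1 * Poly_Mapping.single (sum f A) 1"
    by (simp add: mult_single)
  then show ?case using insert by simp
qed simp_all

lemma single_eq_PVars:
  fixes m :: "'a \<Rightarrow>\<^sub>0 nat" and c :: "'b::field"
  shows "Poly_Mapping.single m c =
    PConst c * (\<Prod>v\<in>Poly_Mapping.keys m. PVar v ^ Poly_Mapping.lookup m v)"
proof -
  have "Poly_Mapping.single m (1::'b) =
    (\<Prod>v\<in>Poly_Mapping.keys m. PVar v ^ Poly_Mapping.lookup m v)"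
    by (subst poly_mapping_sum_singles[of m]) (simp only: single_sum_1 PVar_power)
  moreover have "Poly_Mapping.single m c = PConst c * Poly_Mapping.single m 1"
    by (simp add: PConst_def mult_single)
  ultimately show ?thesis by simp
qed

text \<open>A polynomial is the sum of its terms, and each term is a constant times powers of
  variables from \<open>V\<close>.\<close>

lemma mpoly_ring_induct [consumes 1, case_names const var add mult]:
  assumes "p \<in> carrier (mpoly_ring V)"
    and const: "\<And>c. P (PConst c)"
    and var: "\<And>v. v \<in> V \<Longrightarrow> P (PVar v)"
    and add: "\<And>p q. p \<in> carrier (mpoly_ring V) \<Longrightarrow> q \<in> carrier (mpoly_ring V) \<Longrightarrow>
      P p \<Longrightarrow> P q \<Longrightarrow> P (p + q)"
    and mult: "\<And>p q. p \<in> carrier (mpoly_ring V) \<Longrightarrow> q \<in> carrier (mpoly_ring V) \<Longrightarrow>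
      P p \<Longrightarrow> P q \<Longrightarrow> P (p * q)"
  shows "P p"
proof -
  \<comment> \<open>Ring membership is carried along with \<open>P\<close>, because
    \<open>add\<close> and \<open>mult\<close> ask for it of both operands.\<close>
  define Q where "Q = (\<lambda>p. p \<in> carrier (mpoly_ring V) \<and> P p)"
  have Qc: "Q (PConst c)" for c
    by (simp add: Q_def const)
  then have Q01: "Q 0" "Q 1"
    by (metis PConst_0, metis PConst_1)
  have Qv: "Q (PVar v)" if "v \<in> V" for v
    using that by (simp add: Q_def var)
  have Qa: "Q (p + q)" and Qm: "Q (p * q)" if "Q p" "Q q" for p q
    using that by (simp_all add: Q_def add mult)
  have Qpow: "Q (p ^ k)" if "Q p" for p k
    by (induction k) (simp_all add: that Q01 Qm)
  have Qprod: "Q (\<Prod>x\<in>A. f x)" if "\<And>x. x \<in> A \<Longrightarrow> Q (f x)" for A :: "'a set" and f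
    using that by (induction A rule: infinite_finite_induct) (simp_all add: Q01 Qm)
  have Qsum: "Q (\<Sum>x\<in>A. f x)" if "\<And>x. x \<in> A \<Longrightarrow> Q (f x)" for A :: "('a \<Rightarrow>\<^sub>0 nat) set" and f
    using that by (induction A rule: infinite_finite_induct) (simp_all add: Q01 Qa)
  have "Q (\<Sum>m\<in>Poly_Mapping.keys p. Poly_Mapping.single m (Poly_Mapping.lookup p m))"
    unfolding single_eq_PVars using assms(1)
    by (intro Qsum Qm Qc Qprod Qpow Qv) (auto simp: mem_mpoly_ring)
  then show ?thesis
    by (simp add: Q_def flip: poly_mapping_sum_singles)
qed

section \<open>Ideals and evaluation points\<close>

lemma ideal_subset_mpoly_ring:
  "ideal I (mpoly_ring V) \<Longrightarrow> p \<in> I \<Longrightarrow> p \<in> carrier (mpoly_ring V)"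
  by (metis ideal.Icarr)

lemma mpoly_ideal_add:
  "ideal I (mpoly_ring V) \<Longrightarrow> p \<in> I \<Longrightarrow> q \<in> I \<Longrightarrow> p + q \<in> I"
  using additive_subgroup.a_closed[of I "mpoly_ring V" p q] by (simp add: ideal.axioms(1))

lemma mpoly_ideal_mult:
  "ideal I (mpoly_ring V) \<Longrightarrow> p \<in> carrier (mpoly_ring V) \<Longrightarrow> q \<in> I \<Longrightarrow> p * q \<in> I"
  using ideal.I_l_closed[of I "mpoly_ring V" q p] by simp

lemma mpoly_ideal_diff:
  "ideal I (mpoly_ring V) \<Longrightarrow> p \<in> I \<Longrightarrow> q \<in> I \<Longrightarrow> p - q \<in> I"
  using mpoly_ideal_add[of I V p "PConst (-1) * q"] mpoly_ideal_mult[of I V "PConst (-1)" q]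
  by (simp add: PConst_uminus)

lemma mpoly_ideal_0: "ideal I (mpoly_ring V) \<Longrightarrow> 0 \<in> I"
  using additive_subgroup.zero_closed[of I "mpoly_ring V"] by (simp add: ideal.axioms(1))

lemma mpoly_ideal_sum:
  "ideal I (mpoly_ring V) \<Longrightarrow> (\<And>x. x \<in> A \<Longrightarrow> f x \<in> I) \<Longrightarrow> (\<Sum>x\<in>A. f x) \<in> I"
  by (induction A rule: infinite_finite_induct) (simp_all add: mpoly_ideal_0 mpoly_ideal_add)

lemma ideal_Idl_mpoly_ring:
  "S \<subseteq> carrier (mpoly_ring V) \<Longrightarrow> ideal (Idl\<^bsub>mpoly_ring V\<^esub> S) (mpoly_ring V)"
  using ring.genideal_ideal cring.axioms(1)[OF cring_mpoly_ring] by blast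

lemma Idl_mpoly_ring_self:
  "S \<subseteq> carrier (mpoly_ring V) \<Longrightarrow> p \<in> S \<Longrightarrow> p \<in> Idl\<^bsub>mpoly_ring V\<^esub> S"
  using ring.genideal_self cring.axioms(1)[OF cring_mpoly_ring] by blast

lemma Idl_mpoly_ring_minimal:
  "ideal I (mpoly_ring V) \<Longrightarrow> S \<subseteq> I \<Longrightarrow> Idl\<^bsub>mpoly_ring V\<^esub> S \<subseteq> I"
  using ring.genideal_minimal cring.axioms(1)[OF cring_mpoly_ring] by blast

lemma ideal_peval_kernel: "ideal {p \<in> carrier (mpoly_ring V). peval a p = 0} (mpoly_ring V)"
proof (rule idealI)
  show "ring (mpoly_ring V)"
    by (rule cring.axioms(1)[OF cring_mpoly_ring])
  then have ab: "abelian_group (mpoly_ring V)"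
    by (rule ring.is_abelian_group)
  show "subgroup {p \<in> carrier (mpoly_ring V). peval a p = 0} (add_monoid (mpoly_ring V))"
  proof (rule group.subgroupI)
    show "group (add_monoid (mpoly_ring V))"
      by (rule abelian_group.a_group[OF ab])
    fix p assume p: "p \<in> {p \<in> carrier (mpoly_ring V). peval a p = 0}"
    then have "inv\<^bsub>add_monoid (mpoly_ring V)\<^esub> p = - p"
      using abelian_group.minus_equality[OF ab, of "- p" p] by (simp add: a_inv_def)
    then show "inv\<^bsub>add_monoid (mpoly_ring V)\<^esub> p \<in> {p \<in> carrier (mpoly_ring V). peval a p = 0}"
      using p by simp
  qed (auto intro: exI[of _ 0])
qed auto

text \<open>The polynomials vanishing at \<open>a\<close> form an ideal; once it contains the
  generators, it contains everything they generate.\<close>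

lemma peval_Idl_eq_0:
  assumes "S \<subseteq> carrier (mpoly_ring V)" "\<And>g. g \<in> S \<Longrightarrow> peval a g = 0"
    "p \<in> Idl\<^bsub>mpoly_ring V\<^esub> S"
  shows "peval a p = 0"
  using Idl_mpoly_ring_minimal[OF ideal_peval_kernel[of V a], of S] assms by blast

text \<open>Modulo \<open>I\<close>, each variable from \<open>W\<close> acts on \<open>L\<close> as
  the scalar \<open>a v\<close>. The polynomials that act as their value at \<open>a\<close> contain
  the constants and are closed under sums and products.\<close>

lemma evaluate_modulo_ideal:
  assumes I: "ideal I (mpoly_ring V)" and "W \<subseteq> V"
    and L: "\<And>v. v \<in> W \<Longrightarrow> (PVar v - PConst (a v)) * L \<in> I" "L \<in> carrier (mpoly_ring V)"
    and f: "f \<in> carrier (mpoly_ring W)"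
  shows "(f - PConst (peval a f)) * L \<in> I"
  using f
proof (induction f rule: mpoly_ring_induct)
  case (const c)
  then show ?case using mpoly_ideal_0[OF I] by simp
next
  case (var v)
  then show ?case using L by simp
next
  case (add p q)
  then show ?case
    using mpoly_ideal_add[OF I add(3,4)] by (simp add: PConst_add algebra_simps)
next
  case (mult p q)
  \<comment> \<open>Product rule:
    \<open>p q - p(a) q(a) = p (q - q(a)) + q(a) (p - p(a))\<close>.\<close>
  have "p \<in> carrier (mpoly_ring V)"
    using mult(1) mpoly_ring_mono[OF \<open>W \<subseteq> V\<close>] by blast
  then have "p * ((q - PConst (peval a q)) * L) \<in> I"
    using mult(4) by (rule mpoly_ideal_mult[OF I])
  moreover have "PConst (peval a q) * ((p - PConst (peval a p)) * L) \<in> I"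
    by (rule mpoly_ideal_mult[OF I PConst_in_mpoly_ring mult(3)])
  ultimately have "p * ((q - PConst (peval a q)) * L)
    + PConst (peval a q) * ((p - PConst (peval a p)) * L) \<in> I"
    by (rule mpoly_ideal_add[OF I])
  also have "p * ((q - PConst (peval a q)) * L)
    + PConst (peval a q) * ((p - PConst (peval a p)) * L) = (p * q - PConst (peval a (p * q))) * L"
    by (simp add: PConst_mult algebra_simps)
  finally show ?case .
qed

text \<open>Since the \<open>L t\<close> sum to 1, it is enough to place each \<open>f * L t\<close>
  in \<open>I\<close>. If \<open>pt t\<close> is a zero of \<open>I\<close>, then
  \<open>f * L t\<close> is congruent to \<open>f(pt t) L t = 0\<close>; otherwise some
  \<open>g\<close> in \<open>I\<close> has a nonzero value there, which forces \<open>L t\<close>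
  itself into \<open>I\<close>.\<close>

lemma mem_ideal_if_vanishes_on_zeros:
  assumes I: "ideal I (mpoly_ring V)"
    and L: "\<And>t. t \<in> T \<Longrightarrow> L t \<in> carrier (mpoly_ring V)"
      "\<And>t v. t \<in> T \<Longrightarrow> v \<in> V \<Longrightarrow> (PVar v - PConst (pt t v)) * L t \<in> I"
      "(\<Sum>t\<in>T. L t) = 1"
    and f: "f \<in> carrier (mpoly_ring V)"
      "\<And>t. t \<in> T \<Longrightarrow> (\<And>g. g \<in> I \<Longrightarrow> peval (pt t) g = 0) \<Longrightarrow> peval (pt t) f = 0"
  shows "f \<in> I"
proof -
  have ev: "(g - PConst (peval (pt t) g)) * L t \<in> I"
    if "g \<in> carrier (mpoly_ring V)" "t \<in> T" for g t
    by (rule evaluate_modulo_ideal[OF I subset_refl L(2) L(1) that(1)]) (simp_all add: that)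
  have "f * L t \<in> I" if t: "t \<in> T" for t
  proof (cases "\<forall>g\<in>I. peval (pt t) g = 0")
    case True
    then show ?thesis using ev[OF f(1) t] f(2)[OF t] by simp
  next
    case False
    then obtain g where g: "g \<in> I" "peval (pt t) g \<noteq> 0" by blast
    \<comment> \<open>The difference is the nonzero constant \<open>g(pt t)\<close> times
      \<open>L t\<close>, and the constant can be divided out.\<close>
    have "g * L t - (g - PConst (peval (pt t) g)) * L t \<in> I"
      using mpoly_ideal_mult[OF I L(1)[OF t] g(1)] ev[OF ideal_subset_mpoly_ring[OF I g(1)] t]
      by (intro mpoly_ideal_diff[OF I]) (simp_all add: mult.commute)
    then have "PConst (peval (pt t) g) * L t \<in> I"
      by (simp add: algebra_simps)
    then have "(f * PConst (inverse (peval (pt t) g))) * (PConst (peval (pt t) g) * L t) \<in> I"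
      by (rule mpoly_ideal_mult[OF I, rotated]) (simp add: f(1))
    moreover have "PConst (inverse (peval (pt t) g)) * PConst (peval (pt t) g) = 1"
      using g(2) by (simp flip: PConst_mult)
    ultimately show ?thesis
      by (metis mult.assoc mult_1_left)
  qed
  then have "(\<Sum>t\<in>T. f * L t) \<in> I"
    by (rule mpoly_ideal_sum[OF I])
  then show ?thesis
    by (simp add: L(3) flip: sum_distrib_left)
qed

section \<open>Lagrange idempotents for the roots of unity in one variable\<close>

text \<open>Writing \<open>y = \<omega>\<^sup>-\<^sup>j x\<^sub>v\<close>, this is \<open>(1 + y + \<dots> + y\<^sup>n\<^sup>-\<^sup>1) / n\<close>, the Lagrange basis
  polynomial of the node \<open>\<omega>\<^sup>j\<close> among the \<open>n\<close>-th roots of unity.\<close>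
definition lagrange_idem :: "'k::field \<Rightarrow> nat \<Rightarrow> nat \<Rightarrow> 'v \<Rightarrow> ('v, 'k) mpoly" where
  "lagrange_idem \<omega> n j v =
    PConst (inverse (of_nat n)) * (\<Sum>k<n. (PConst (inverse (\<omega> ^ j)) * PVar v) ^ k)"

lemma primitive_root_inj:
  assumes "primitive_root_of_unity n \<omega>" "i < n" "j < n" "\<omega> ^ i = \<omega> ^ j"
  shows "i = j"
proof -
  have "\<omega> \<noteq> 0"
    using assms(1) by (auto simp: primitive_root_of_unity_def power_0_left split: if_splits)
  have "\<not> i < j" if "i < n" "j < n" "\<omega> ^ i = \<omega> ^ j" for i j
  proof
    assume "i < j"
    then have "\<omega> ^ (j - i) = 1"
      using that \<open>\<omega> \<noteq> 0\<close> by (simp add: power_diff)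
    then show False
      using assms(1) that \<open>i < j\<close> by (auto simp: primitive_root_of_unity_def)
  qed
  then show ?thesis
    using assms by (metis linorder_neqE_nat)
qed

lemma primitive_root_nonzero: "primitive_root_of_unity n \<omega> \<Longrightarrow> \<omega> \<noteq> 0"
  by (auto simp: primitive_root_of_unity_def power_0_left split: if_splits)

text \<open>The geometric sum telescopes: \<open>(y - 1) (1 + ... + y^(n-1)) = y^n - 1\<close>, and
  \<open>y^n\<close> is the n-th power of the variable because \<open>\<omega>^j\<close> is an n-th
  root of unity. Hence modulo \<open>x^n - 1\<close> the variable acts on the idempotent as
  \<open>\<omega>^j\<close>.\<close>

lemma lagrange_idem_mult:
  assumes "primitive_root_of_unity n \<omega>"
  shows "(PVar v - PConst (\<omega> ^ j)) * lagrange_idem \<omega> n j v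
    = PConst (\<omega> ^ j / of_nat n) * (PVar v ^ n - 1)"
proof -
  have [simp]: "\<omega> \<noteq> 0" by (rule primitive_root_nonzero[OF assms])
  have "(\<omega> ^ j) ^ n = 1"
    using assms by (metis mult.commute power_mult power_one primitive_root_of_unity_def)
  define y where "y = PConst (inverse (\<omega> ^ j)) * PVar v"
  have "y ^ n = PVar v ^ n"
    using \<open>(\<omega> ^ j) ^ n = 1\<close>
    by (simp add: y_def power_mult_distrib flip: PConst_power) (simp add: power_inverse)
  have v: "PVar v = PConst (\<omega> ^ j) * y"
    by (simp add: y_def mult.assoc[symmetric] flip: PConst_mult)
  have "(PVar v - PConst (\<omega> ^ j)) * lagrange_idem \<omega> n j v
    = PConst (\<omega> ^ j) * PConst (inverse (of_nat n)) * ((y - 1) * (\<Sum>k<n. y ^ k))"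
    unfolding lagrange_idem_def y_def[symmetric] by (subst v) (simp add: algebra_simps)
  then show ?thesis
    by (simp add: \<open>y ^ n = PVar v ^ n\<close> divide_inverse PConst_mult flip: power_diff_1_eq)
qed

text \<open>The coefficient of the k-th power is \<open>1/n\<close> times a sum of powers of
  \<open>\<omega>^(-k)\<close>, which by orthogonality is 1 for \<open>k = 0\<close> and 0 for
  \<open>0 < k < n\<close>. Invertibility of \<open>n\<close> in the field enters here.\<close>

lemma sum_lagrange_idem:
  fixes \<omega> :: "'k::field"
  assumes \<omega>: "primitive_root_of_unity n \<omega>" and n: "of_nat n \<noteq> (0::'k)"
  shows "(\<Sum>j<n. lagrange_idem \<omega> n j v) = 1"
proof -
  have pos: "n > 0" and [simp]: "\<omega> \<noteq> 0" and "\<omega> ^ n = 1"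
    using \<omega> primitive_root_nonzero by (auto simp: primitive_root_of_unity_def)
  have geo: "(\<Sum>j<n. inverse (\<omega> ^ j) ^ k) = (if k = 0 then of_nat n else 0)" if "k < n" for k
  proof (cases "k = 0")
    case False
    then have "\<omega> ^ k \<noteq> 1"
      using \<omega> that by (auto simp: primitive_root_of_unity_def)
    then have "inverse \<omega> ^ k \<noteq> 1"
      by (simp add: power_inverse)
    moreover have "(inverse \<omega> ^ k) ^ n = 1"
      using \<open>\<omega> ^ n = 1\<close> by (metis inverse_1 mult.commute power_inverse power_mult power_one)
    ultimately have "(\<Sum>j<n. (inverse \<omega> ^ k) ^ j) = 0"
      by (simp add: geometric_sum)
    moreover have "(inverse \<omega> ^ k) ^ j = inverse (\<omega> ^ j) ^ k" for j
      by (metis mult.commute power_inverse power_mult)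
    ultimately show ?thesis using False by simp
  qed simp
  have "(\<Sum>j<n. lagrange_idem \<omega> n j v)
    = PConst (inverse (of_nat n)) * (\<Sum>k<n. PConst (\<Sum>j<n. inverse (\<omega> ^ j) ^ k) * PVar v ^ k)"
    unfolding lagrange_idem_def sum_distrib_left[symmetric] PConst_sum sum_distrib_right
    by (subst sum.swap) (simp add: power_mult_distrib PConst_power)
  also have "(\<Sum>k<n. PConst (\<Sum>j<n. inverse (\<omega> ^ j) ^ k) * PVar v ^ k)
    = (\<Sum>k<n. if k = 0 then PConst (of_nat n) else 0)"
    by (intro sum.cong refl) (simp add: geo)
  also have "\<dots> = PConst (of_nat n)"
    using pos by simp
  finally show ?thesis
    using n by (simp flip: PConst_mult)
qed

lemma lagrange_idem_in_mpoly_ring [simp]: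
  "v \<in> V \<Longrightarrow> lagrange_idem \<omega> n j v \<in> carrier (mpoly_ring V)"
  unfolding lagrange_idem_def by (intro mult_in_mpoly_ring sum_in_mpoly_ring) simp_all

section \<open>Cycle ideals\<close>

text \<open>The powers of \<omega> and of its inverse solve the same linear recurrence of order two,
  so the value at index \<open>i\<close> is a fixed combination of those at -1 and 0. The fractions
  are, up to sign, the interpolation coefficients; the indices -1 and 0 stand for the last two
  vertices of the cycle.\<close>

lemma doubly_covered_coeffs:
  fixes \<omega> :: "'k::field"
  assumes "\<omega> \<noteq> 0" "\<omega> ^ 3 - \<omega> \<noteq> 0" "\<zeta> = \<omega> \<or> \<zeta> = inverse \<omega>"
  shows "\<zeta> ^ i + (\<omega> powi (2 + int i) - \<omega> powi (2 - int i)) / (\<omega> ^ 3 - \<omega>) * inverse \<zeta>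
    + (\<omega> powi (1 - int i) - \<omega> powi (3 + int i)) / (\<omega> ^ 3 - \<omega>) = 0"
proof -
  \<comment> \<open>With \<open>W = \<omega>^i\<close> the integer powers disappear and the claim
    becomes a rational identity in \<open>\<omega>\<close> and \<open>W\<close>.\<close>
  define W where "W = \<omega> ^ i"
  have [simp]: "W \<noteq> 0" using assms(1) by (simp add: W_def)
  have p: "\<omega> powi (2 + int i) = \<omega>\<^sup>2 * W" "\<omega> powi (2 - int i) = \<omega>\<^sup>2 / W"
    "\<omega> powi (1 - int i) = \<omega> / W" "\<omega> powi (3 + int i) = \<omega> ^ 3 * W"
    using assms(1) by (simp_all add: power_int_add power_int_diff W_def)
  have z: "\<zeta> ^ i = W \<and> \<zeta> = \<omega> \<or> \<zeta> ^ i = inverse W \<and> \<zeta> = inverse \<omega>"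
    using assms(3) by (auto simp: W_def power_inverse)
  define D where "D = \<omega> ^ 3 - \<omega>"
  have "D \<noteq> 0" using assms(2) by (simp add: D_def)
  \<comment> \<open>The denominator \<open>D\<close> stays opaque while it is cleared and is
    expanded only afterwards.\<close>
  have "(\<zeta> ^ i + (\<omega>\<^sup>2 * W - \<omega>\<^sup>2 / W) / D * inverse \<zeta> + (\<omega> / W - \<omega> ^ 3 * W) / D) * D
    = \<zeta> ^ i * D + (\<omega>\<^sup>2 * W - \<omega>\<^sup>2 / W) * inverse \<zeta> + (\<omega> / W - \<omega> ^ 3 * W)"
    using \<open>D \<noteq> 0\<close> by (simp add: distrib_right)
  also have "\<dots> = 0"
    using z
  proof (elim disjE conjE)
    assume \<zeta>: "\<zeta> ^ i = W" "\<zeta> = \<omega>"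
    show ?thesis
      unfolding \<zeta>(1) unfolding \<zeta>(2) D_def using assms(1)
      by (simp add: field_simps power2_eq_square power3_eq_cube)
  next
    assume \<zeta>: "\<zeta> ^ i = inverse W" "\<zeta> = inverse \<omega>"
    show ?thesis
      unfolding \<zeta>(1) unfolding \<zeta>(2) D_def using assms(1)
      by (simp add: field_simps power2_eq_square power3_eq_cube)
  qed
  finally show ?thesis
    using \<open>D \<noteq> 0\<close> unfolding p by (simp add: D_def)
qed

section \<open>Generators of a cycle ideal and points where they vanish\<close>

definition cycle_gens :: "'v pair_pre_digraph \<Rightarrow> 'k::field \<Rightarrow> 'v list \<Rightarrow> ('v, 'k) mpoly set" where
  "cycle_gens G \<omega> vs = (if doubly_covered G (cycle_arcs vs) then doubly_covered_gens \<omega> vs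
     else directed_gens \<omega> vs)"

lemma cycle_gens_in_mpoly_ring:
  assumes "2 < length vs"
  shows "cycle_gens G \<omega> vs \<subseteq> carrier (mpoly_ring (set vs))"
proof -
  have [simp]: "vs ! (length vs - Suc i) \<in> set vs" for i
    using assms by (intro nth_mem) linarith
  have [simp]: "vs ! (length vs - i) \<in> set vs" "vs ! (i - Suc 0) \<in> set vs"
    if "Suc 0 \<le> i" "i \<le> length vs" for i
    using that by (auto intro!: nth_mem)
  show ?thesis
    using assms by (auto simp: cycle_gens_def doubly_covered_gens_def directed_gens_def Let_def)
qed

lemma ideal_cycle_ideal:
  "2 < length vs \<Longrightarrow> ideal (cycle_ideal G \<omega> vs) (mpoly_ring (set vs))"
  unfolding cycle_ideal_def cycle_gens_def[symmetric]
  by (intro ideal_Idl_mpoly_ring cycle_gens_in_mpoly_ring)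

lemma cycle_gens_in_cycle_ideal:
  "2 < length vs \<Longrightarrow> g \<in> cycle_gens G \<omega> vs \<Longrightarrow> g \<in> cycle_ideal G \<omega> vs"
  unfolding cycle_ideal_def cycle_gens_def[symmetric]
  by (intro Idl_mpoly_ring_self cycle_gens_in_mpoly_ring)

text \<open>Both follow from \<open>\<omega>^2 \<noteq> 1\<close>, which holds as
  \<open>2 < n\<close>. The first keeps the denominator in the generators of a doubly covered cycle
  nonzero, the second separates the zeros of its two orientations.\<close>

lemma primitive_root_cubed:
  assumes "primitive_root_of_unity n \<omega>" "2 < n"
  shows "\<omega> ^ 3 - \<omega> \<noteq> 0" "inverse \<omega> \<noteq> \<omega>"
proof -
  have "\<omega> \<noteq> 0"
    by (rule primitive_root_nonzero[OF assms(1)])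
  have "\<omega>\<^sup>2 \<noteq> 1"
    using assms by (auto simp: primitive_root_of_unity_def)
  then show "inverse \<omega> \<noteq> \<omega>"
    using right_inverse[OF \<open>\<omega> \<noteq> 0\<close>] by (auto simp: power2_eq_square)
  have "\<omega> ^ 3 - \<omega> = \<omega> * (\<omega>\<^sup>2 - 1)"
    by (simp add: power2_eq_square power3_eq_cube algebra_simps)
  then show "\<omega> ^ 3 - \<omega> \<noteq> 0"
    using \<open>\<omega> \<noteq> 0\<close> \<open>\<omega>\<^sup>2 \<noteq> 1\<close> by simp
qed

text \<open>Every generator is checked at the point. Only points with ratio \<omega> occur, for both
  kinds of cycle: these are the ones that a zero of the Hamiltonian ideal produces on the cycle it
  traces out.\<close>

lemma peval_cycle_ideal:
  assumes \<omega>: "primitive_root_of_unity (length vs) \<omega>" and len: "2 < length vs"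
    and c: "c ^ length vs = 1" and a: "\<And>i. i < length vs \<Longrightarrow> a (vs ! i) = \<omega> ^ Suc i * c"
    and p: "p \<in> cycle_ideal G \<omega> vs"
  shows "peval a p = 0"
proof -
  let ?n = "length vs"
  have [simp]: "\<omega> \<noteq> 0" and [simp]: "\<omega> ^ ?n = 1"
    using \<omega> primitive_root_nonzero by (auto simp: primitive_root_of_unity_def)
  \<comment> \<open>The list is indexed from 0, so \<open>vs ! (i - 1)\<close> is the i-th vertex;
    the last one carries \<open>c\<close> because \<open>\<omega>^k = 1\<close> for the length
    \<open>k\<close>.\<close>
  have x: "a (vs ! (i - 1)) = \<omega> ^ i * c" if "1 \<le> i" "i \<le> ?n" for i
    using a[of "i - 1"] that by simp
  have xk: "a (vs ! (?n - 1)) = c"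
    using x[of ?n] len by simp
  have "Suc (?n - 1) = ?n"
    using len by linarith
  then have "\<omega> * \<omega> ^ (?n - 1) = 1"
    using \<open>\<omega> ^ ?n = 1\<close> by (metis power_Suc)
  then have "\<omega> ^ (?n - 1) = inverse \<omega>"
    by (simp add: inverse_unique)
  then have xk1: "a (vs ! (?n - 1 - 1)) = inverse \<omega> * c"
    using x[of "?n - 1"] len by simp
  have "peval a g = 0" if g: "g \<in> cycle_gens G \<omega> vs" for g
  proof (cases "doubly_covered G (cycle_arcs vs)")
    case True
    have linear: "\<omega> ^ i * c + A * (inverse \<omega> * c) + B * c = 0"
      if "\<omega> ^ i + A * inverse \<omega> + B = 0" for i A B
    proof -
      have "\<omega> ^ i * c + A * (inverse \<omega> * c) + B * c = (\<omega> ^ i + A * inverse \<omega> + B) * c"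
        by (simp add: algebra_simps)
      then show ?thesis using that by simp
    qed
    note linear = linear[OF doubly_covered_coeffs[OF _ primitive_root_cubed(1)[OF \<omega> len]]]
    from g True consider (lin) i where "1 \<le> i" "i \<le> ?n - 2"
        "g = PVar (vs ! (i - 1))
          + PConst ((\<omega> powi (2 + int i) - \<omega> powi (2 - int i)) / (\<omega> ^ 3 - \<omega>)) * PVar (vs ! (?n - 1 - 1))
          + PConst ((\<omega> powi (1 - int i) - \<omega> powi (3 + int i)) / (\<omega> ^ 3 - \<omega>)) * PVar (vs ! (?n - 1))"
      | (quad) "g = (PVar (vs ! (?n - 1 - 1)) - PConst \<omega> * PVar (vs ! (?n - 1)))
          * (PVar (vs ! (?n - 1 - 1)) - PConst (inverse \<omega>) * PVar (vs ! (?n - 1)))"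
      | (pow) "g = PVar (vs ! (?n - 1)) ^ ?n - 1"
      unfolding cycle_gens_def doubly_covered_gens_def Let_def by auto
    then show ?thesis
    proof cases
      case lin
      then show ?thesis
        using linear[of i] x[of i] by (simp only: peval_add peval_mult peval_PConst peval_PVar xk xk1) simp
    next
      case quad
      show ?thesis
        unfolding quad by (simp only: peval_diff peval_mult peval_PConst peval_PVar xk xk1) simp
    next
      case pow
      show ?thesis
        unfolding pow by (simp only: peval_diff peval_power peval_1 peval_PVar xk c) simp
    qed
  next
    case False
    from g False consider (lin) i where "1 \<le> i" "i \<le> ?n - 1"
        "g = PVar (vs ! (?n - i - 1)) - PConst (\<omega> ^ (?n - i)) * PVar (vs ! (?n - 1))"
      | (pow) "g = PVar (vs ! (?n - 1)) ^ ?n - 1"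
      unfolding cycle_gens_def directed_gens_def Let_def by auto
    then show ?thesis
    proof cases
      case lin
      then show ?thesis
        using x[of "?n - i"] len by (simp only: peval_diff peval_mult peval_PConst peval_PVar xk) simp
    next
      case pow
      show ?thesis
        unfolding pow by (simp only: peval_diff peval_power peval_1 peval_PVar xk c) simp
    qed
  qed
  then show ?thesis
    using peval_Idl_eq_0[OF cycle_gens_in_mpoly_ring[OF len]] p
    unfolding cycle_ideal_def cycle_gens_def[symmetric] by blast
qed

text \<open>The linear generators make every variable a multiple of the last one, so the idempotents
  in that single variable already fix all coordinates.\<close>

lemma mem_directed_cycle_ideal:
  fixes \<omega> :: "'k::field"
  assumes \<omega>: "primitive_root_of_unity (length vs) \<omega>" and len: "2 < length vs"
    and n: "of_nat (length vs) \<noteq> (0::'k)" and vs: "distinct vs"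
    and dir: "\<not> doubly_covered G (cycle_arcs vs)"
    and f: "f \<in> carrier (mpoly_ring (set vs))"
      "\<And>a c. c ^ length vs = 1 \<Longrightarrow> (\<And>i. i < length vs \<Longrightarrow> a (vs ! i) = \<omega> ^ Suc i * c) \<Longrightarrow> peval a f = 0"
  shows "f \<in> cycle_ideal G \<omega> vs"
proof -
  let ?n = "length vs"
  define I where "I = cycle_ideal G \<omega> vs"
  have I: "ideal I (mpoly_ring (set vs))"
    unfolding I_def by (rule ideal_cycle_ideal[OF len])
  define x where "x = vs ! (?n - 1)"
  have x: "x \<in> set vs"
    unfolding x_def using len by (intro nth_mem) linarith
  have gen: "PVar (vs ! i) - PConst (\<omega> ^ Suc i) * PVar x \<in> I" if "Suc i < ?n" for i
  proof -
    \<comment> \<open>The directed generators count backwards from the last vertex, so the one for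
      \<open>vs ! i\<close> has number \<open>?n - Suc i\<close>.\<close>
    have "?n - (?n - Suc i) = Suc i" "?n - (?n - Suc i) - 1 = i"
      using that by simp_all
    then have "PVar (vs ! i) - PConst (\<omega> ^ Suc i) * PVar x \<in> directed_gens \<omega> vs"
      unfolding directed_gens_def Let_def x_def using that
      by (intro UnI1 CollectI exI[of _ "?n - Suc i"]) (simp, linarith)
    then show ?thesis
      unfolding I_def using dir by (intro cycle_gens_in_cycle_ideal[OF len]) (simp add: cycle_gens_def)
  qed
  have pow: "PVar x ^ ?n - 1 \<in> I"
    unfolding I_def using dir
    by (intro cycle_gens_in_cycle_ideal[OF len]) (simp add: cycle_gens_def directed_gens_def x_def Let_def)
  \<comment> \<open>Position of a vertex in \<open>vs\<close>, used to write a point as a function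
    on vertices.\<close>
  define idx where "idx = the_inv_into {..<?n} ((!) vs)"
  have idx: "idx (vs ! i) = i" if "i < ?n" for i
    unfolding idx_def using that vs by (intro the_inv_into_f_f) (auto simp: inj_on_def nth_eq_iff_index_eq)
  have unit: "(\<omega> ^ j) ^ ?n = 1" for j
    using \<omega> by (metis mult.commute power_mult power_one primitive_root_of_unity_def)
  define pt where "pt = (\<lambda>j v. \<omega> ^ Suc (idx v) * \<omega> ^ j)"
  have ev_x: "(PVar x - PConst (\<omega> ^ j)) * lagrange_idem \<omega> ?n j x \<in> I" for j
    unfolding lagrange_idem_mult[OF \<omega>] by (intro mpoly_ideal_mult[OF I _ pow]) simp
  have "f \<in> I"
  proof (rule mem_ideal_if_vanishes_on_zeros[OF I, of "{..<?n}" "\<lambda>j. lagrange_idem \<omega> ?n j x" pt])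
    show "(\<Sum>j<?n. lagrange_idem \<omega> ?n j x) = 1"
      by (rule sum_lagrange_idem[OF \<omega> n])
    fix j v assume "v \<in> set vs"
    then obtain i where i: "i < ?n" "v = vs ! i"
      by (metis in_set_conv_nth)
    show "(PVar v - PConst (pt j v)) * lagrange_idem \<omega> ?n j x \<in> I"
    proof (cases "Suc i < ?n")
      \<comment> \<open>Last position: the vertex is \<open>x\<close> itself, and its factor
        \<open>\<omega> ^ ?n\<close> is 1.\<close>
      case False
      then have "v = x" "Suc i = ?n"
        using i by (auto simp: x_def intro!: arg_cong[of _ _ "(!) vs"])
      have "\<omega> ^ Suc i = 1"
        using \<omega> \<open>Suc i = ?n\<close> by (simp only: primitive_root_of_unity_def)
      then have "pt j v = \<omega> ^ j"
        unfolding i(2) pt_def idx[OF i(1)] by simp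
      then show ?thesis
        using ev_x \<open>v = x\<close> by simp
    next
      case True
      \<comment> \<open>The generator replaces the variable of \<open>v\<close> by a multiple of
        that of \<open>x\<close>, which then acts as \<open>\<omega>^j\<close>.\<close>
      have "lagrange_idem \<omega> ?n j x * (PVar v - PConst (\<omega> ^ Suc i) * PVar x)
        + PConst (\<omega> ^ Suc i) * ((PVar x - PConst (\<omega> ^ j)) * lagrange_idem \<omega> ?n j x) \<in> I"
        unfolding i(2) using x
        by (intro mpoly_ideal_add[OF I] mpoly_ideal_mult[OF I _ gen[OF True]]
            mpoly_ideal_mult[OF I _ ev_x]) simp_all
      also have "lagrange_idem \<omega> ?n j x * (PVar v - PConst (\<omega> ^ Suc i) * PVar x)
        + PConst (\<omega> ^ Suc i) * ((PVar x - PConst (\<omega> ^ j)) * lagrange_idem \<omega> ?n j x)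
        = (PVar v - PConst (pt j v)) * lagrange_idem \<omega> ?n j x"
        unfolding pt_def using i by (simp only: idx PConst_mult) (simp add: algebra_simps)
      finally show ?thesis .
    qed
  next
    fix j
    show "peval (pt j) f = 0"
      using unit[of j] by (rule f(2)) (simp add: pt_def idx)
  qed (simp_all add: x f)
  then show ?thesis by (simp add: I_def)
qed

text \<open>As \<open>w w' = 1\<close>, the quadratic is \<open>y^2 - (w + w') u y + u^2\<close>,
  and its values at \<open>u = c\<close> and \<open>u = x\<close> differ by a multiple of
  \<open>x - c\<close>. This allows the last variable in the quadratic generator to be replaced by
  its value.\<close>

lemma quadratic_substitution:
  fixes w w' :: "'a::comm_ring_1"
  assumes "w * w' = 1"
  shows "l * ((y - w * x) * (y - w' * x)) + ((w + w') * y - (x + c)) * ((x - c) * l)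
    = (y - w * c) * (y - w' * c) * l"
proof -
  have expand: "(y - w * u) * (y - w' * u) = y * y - (w + w') * (u * y) + u * u" for u
  proof -
    have "(y - w * u) * (y - w' * u) = y * y - (w + w') * (u * y) + w * w' * (u * u)"
      by (simp add: algebra_simps)
    then show ?thesis using assms by simp
  qed
  show ?thesis
    unfolding expand by (simp add: algebra_simps)
qed

text \<open>All variables are combinations of the last two. Once the last one is fixed at
  \<open>\<omega>^j\<close>, the quadratic generator leaves two values for the one before it, one
  for each orientation.\<close>

lemma mem_doubly_covered_cycle_ideal:
  fixes \<omega> :: "'k::field"
  assumes \<omega>: "primitive_root_of_unity (length vs) \<omega>" and len: "2 < length vs"
    and n: "of_nat (length vs) \<noteq> (0::'k)" and vs: "distinct vs"
    and dc: "doubly_covered G (cycle_arcs vs)"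
    and f: "f \<in> carrier (mpoly_ring (set vs))"
      "\<And>a c \<zeta>. c ^ length vs = 1 \<Longrightarrow> \<zeta> = \<omega> \<or> \<zeta> = inverse \<omega> \<Longrightarrow>
        (\<And>i. i < length vs \<Longrightarrow> a (vs ! i) = \<zeta> ^ Suc i * c) \<Longrightarrow> peval a f = 0"
  shows "f \<in> cycle_ideal G \<omega> vs"
proof -
  let ?n = "length vs"
  define I where "I = cycle_ideal G \<omega> vs"
  have I: "ideal I (mpoly_ring (set vs))"
    unfolding I_def by (rule ideal_cycle_ideal[OF len])
  have [simp]: "\<omega> \<noteq> 0"
    by (rule primitive_root_nonzero[OF \<omega>])
  have \<omega>n: "\<omega> ^ ?n = 1"
    using \<omega> by (simp add: primitive_root_of_unity_def)
  define x where "x = vs ! (?n - 1)"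
  define y where "y = vs ! (?n - 1 - 1)"
  have x: "x \<in> set vs" and y: "y \<in> set vs"
    unfolding x_def y_def using len by (auto intro!: nth_mem)
  define A where "A i = (\<omega> powi (2 + int i) - \<omega> powi (2 - int i)) / (\<omega> ^ 3 - \<omega>)" for i
  define B where "B i = (\<omega> powi (1 - int i) - \<omega> powi (3 + int i)) / (\<omega> ^ 3 - \<omega>)" for i
  have gen: "PVar (vs ! i) + PConst (A (Suc i)) * PVar y + PConst (B (Suc i)) * PVar x \<in> I"
    if "Suc i \<le> ?n - 2" for i
  proof -
    have "PVar (vs ! i) + PConst (A (Suc i)) * PVar y + PConst (B (Suc i)) * PVar x
        \<in> doubly_covered_gens \<omega> vs"
      unfolding doubly_covered_gens_def Let_def x_def y_def A_def B_def using that
      by (intro UnI1 CollectI exI[of _ "Suc i"]) simp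
    then show ?thesis
      unfolding I_def using dc by (intro cycle_gens_in_cycle_ideal[OF len]) (simp add: cycle_gens_def)
  qed
  have quad: "(PVar y - PConst \<omega> * PVar x) * (PVar y - PConst (inverse \<omega>) * PVar x) \<in> I"
    and pow: "PVar x ^ ?n - 1 \<in> I"
    unfolding I_def using dc
    by (intro cycle_gens_in_cycle_ideal[OF len];
        simp add: cycle_gens_def doubly_covered_gens_def x_def y_def Let_def)+
  define idx where "idx = the_inv_into {..<?n} ((!) vs)"
  have idx: "idx (vs ! i) = i" if "i < ?n" for i
    unfolding idx_def using that vs by (intro the_inv_into_f_f) (auto simp: inj_on_def nth_eq_iff_index_eq)
  have unit: "(\<omega> ^ j) ^ ?n = 1" for j
    using \<omega>n by (metis mult.commute power_mult power_one)
  \<comment> \<open>\<open>\<zeta>\<close> chooses the orientation and \<open>\<omega>^j\<close> is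
    the value at the last vertex \<open>x\<close>; the vertex \<open>y\<close> before it has the
    value \<open>inverse \<zeta> * \<omega>^j\<close>, since
    \<open>\<zeta> ^ ?n = 1\<close>.\<close>
  define T where "T = {\<omega>, inverse \<omega>} \<times> {..<?n}"
  define pt where "pt = (\<lambda>(\<zeta>, j) v. \<zeta> ^ Suc (idx v) * \<omega> ^ j)"
  \<comment> \<open>The factor in \<open>y\<close> is the linear Lagrange polynomial with value 1 at
    the node \<open>inverse \<zeta> * \<omega>^j\<close> and 0 at the other node
    \<open>\<zeta> * \<omega>^j\<close>.\<close>
  define L where "L = (\<lambda>(\<zeta>, j). PConst (inverse ((inverse \<zeta> - \<zeta>) * \<omega> ^ j))
    * (PVar y - PConst (\<zeta> * \<omega> ^ j)) * lagrange_idem \<omega> ?n j x)"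
  have L_carrier: "L t \<in> carrier (mpoly_ring (set vs))" for t
    using x y by (cases t) (simp add: L_def)
  have ev_lag: "(PVar x - PConst (\<omega> ^ j)) * lagrange_idem \<omega> ?n j x \<in> I" for j
    unfolding lagrange_idem_mult[OF \<omega>] by (intro mpoly_ideal_mult[OF I _ pow]) simp
  have ev_x: "(PVar x - PConst (\<omega> ^ j)) * L (\<zeta>, j) \<in> I" for \<zeta> j
  proof -
    have "(PConst (inverse ((inverse \<zeta> - \<zeta>) * \<omega> ^ j)) * (PVar y - PConst (\<zeta> * \<omega> ^ j)))
      * ((PVar x - PConst (\<omega> ^ j)) * lagrange_idem \<omega> ?n j x) \<in> I"
      using y by (intro mpoly_ideal_mult[OF I _ ev_lag]) simp
    then show ?thesis
      by (simp add: L_def ac_simps)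
  qed
  have ev_y: "(PVar y - PConst (inverse \<zeta> * \<omega> ^ j)) * L (\<zeta>, j) \<in> I"
    if \<zeta>: "\<zeta> = \<omega> \<or> \<zeta> = inverse \<omega>" for \<zeta> j
  proof -
    let ?l = "lagrange_idem \<omega> ?n j x" and ?c = "PConst (\<omega> ^ j)"
    let ?X = "PVar x :: ('a, 'k) mpoly" and ?Y = "PVar y :: ('a, 'k) mpoly"
    let ?w = "PConst \<omega> :: ('a, 'k) mpoly" and ?w' = "PConst (inverse \<omega>) :: ('a, 'k) mpoly"
    have ww: "?w * ?w' = 1"
      by (simp flip: PConst_mult)
    \<comment> \<open>The quadratic generator times the idempotent, corrected so that
      \<open>x\<close> is replaced by its value \<open>\<omega>^j\<close>.\<close>
    have "?l * ((?Y - ?w * ?X) * (?Y - ?w' * ?X))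
        + ((?w + ?w') * ?Y - (?X + ?c)) * ((?X - ?c) * ?l) \<in> I"
      using x y by (intro mpoly_ideal_add[OF I] mpoly_ideal_mult[OF I _ quad]
          mpoly_ideal_mult[OF I _ ev_lag]) simp_all
    also have "?l * ((?Y - ?w * ?X) * (?Y - ?w' * ?X))
        + ((?w + ?w') * ?Y - (?X + ?c)) * ((?X - ?c) * ?l)
      = (?Y - ?w * ?c) * (?Y - ?w' * ?c) * ?l"
      by (rule quadratic_substitution[OF ww])
    finally have "(?Y - ?w * ?c) * (?Y - ?w' * ?c) * ?l \<in> I" .
    then have "PConst (inverse ((inverse \<zeta> - \<zeta>) * \<omega> ^ j)) *
        ((?Y - ?w * ?c) * (?Y - ?w' * ?c) * ?l) \<in> I"
      by (rule mpoly_ideal_mult[OF I PConst_in_mpoly_ring])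
    \<comment> \<open>Both choices of \<open>\<zeta>\<close> give the same two linear factors, up to
      order.\<close>
    moreover have "(?Y - ?w * ?c) * (?Y - ?w' * ?c)
        = (?Y - PConst (inverse \<zeta> * \<omega> ^ j)) * (?Y - PConst (\<zeta> * \<omega> ^ j))"
      using \<zeta> by (auto simp: PConst_mult)
    ultimately show ?thesis
      by (simp add: L_def ac_simps)
  qed
  have "f \<in> I"
  proof (rule mem_ideal_if_vanishes_on_zeros[OF I, of T L pt])
    have ne: "inverse \<omega> \<noteq> \<omega>"
      by (rule primitive_root_cubed(2)[OF \<omega> len])
    have "L (\<omega>, j) + L (inverse \<omega>, j) = lagrange_idem \<omega> ?n j x" for j
    proof -
      \<comment> \<open>The two linear Lagrange polynomials have normalising constants
        \<open>d\<close> and \<open>- d\<close>, so \<open>y\<close> cancels in their sum and only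
        the constant 1 remains.\<close>
      define d where "d = inverse ((inverse \<omega> - \<omega>) * \<omega> ^ j)"
      have d': "inverse ((inverse (inverse \<omega>) - inverse \<omega>) * \<omega> ^ j) = - d"
        unfolding d_def by (metis inverse_inverse_eq inverse_minus_eq minus_diff_eq mult_minus_left)
      have "d * (inverse \<omega> * \<omega> ^ j) - d * (\<omega> * \<omega> ^ j) = 1"
        unfolding right_diff_distrib[symmetric] left_diff_distrib[symmetric] d_def
        using ne by (intro left_inverse) simp
      then have "PConst (d * (inverse \<omega> * \<omega> ^ j)) - PConst (d * (\<omega> * \<omega> ^ j)) = (1 :: ('a, 'k) mpoly)"
        by (simp flip: PConst_diff)
      then have "(PConst d * PConst (inverse \<omega> * \<omega> ^ j) - PConst d * PConst (\<omega> * \<omega> ^ j))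
          * lagrange_idem \<omega> ?n j x = lagrange_idem \<omega> ?n j x"
        by (simp only: PConst_mult mult_1)
      then show ?thesis
        unfolding L_def prod.case d' unfolding d_def[symmetric]
        by (simp add: PConst_uminus algebra_simps)
    qed
    \<comment> \<open>As \<open>\<omega>\<close> and its inverse differ, the sum over
      \<open>T\<close> splits into these pairs, one for each \<open>j\<close>.\<close>
    then show "(\<Sum>t\<in>T. L t) = 1"
      unfolding T_def sum.cartesian_product'
      using ne sum_lagrange_idem[OF \<omega> n, of x] by (simp flip: sum.distrib)
  next
    fix t v assume "t \<in> T" "v \<in> set vs"
    then obtain \<zeta> j i where i: "i < ?n" "v = vs ! i" and t: "t = (\<zeta>, j)"
      and \<zeta>: "\<zeta> = \<omega> \<or> \<zeta> = inverse \<omega>"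
      by (auto simp: T_def in_set_conv_nth)
    have \<zeta>n: "\<zeta> ^ ?n = 1" and [simp]: "\<zeta> \<noteq> 0"
      using \<zeta> \<omega>n by (auto simp: power_inverse)
    \<comment> \<open>The last two vertices are handled by \<open>ev_x\<close> and
      \<open>ev_y\<close>; every other one has a linear generator.\<close>
    consider "Suc i = ?n" | "Suc (Suc i) = ?n" | "Suc i \<le> ?n - 2"
      using i by linarith
    then show "(PVar v - PConst (pt t v)) * L t \<in> I"
    proof cases
      case 1
      then have "v = x"
        using i by (simp add: x_def flip: 1)
      moreover have "pt t v = \<omega> ^ j"
        using \<zeta>n i 1 by (simp only: t pt_def prod.case idx mult_1)
      ultimately show ?thesis
        using ev_x t by simp
    next
      case 2
      then have "v = y"
        using i by (simp add: y_def flip: 2)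
      have "\<zeta> * \<zeta> ^ Suc i = 1"
        using \<zeta>n by (simp add: 2 flip: power_Suc)
      then have "\<zeta> ^ Suc i = inverse \<zeta>"
        by (simp add: inverse_unique)
      then have "pt t v = inverse \<zeta> * \<omega> ^ j"
        using i by (simp only: t pt_def prod.case idx)
      then show ?thesis
        using ev_y[OF \<zeta>] t \<open>v = y\<close> by simp
    next
      case 3
      let ?A = "A (Suc i)" and ?B = "B (Suc i)"
      have "\<zeta> ^ Suc i + ?A * inverse \<zeta> + ?B = 0"
        unfolding A_def B_def
        by (rule doubly_covered_coeffs[OF _ primitive_root_cubed(1)[OF \<omega> len] \<zeta>]) simp
      then have "(\<zeta> ^ Suc i + ?A * inverse \<zeta> + ?B) * \<omega> ^ j = 0"
        by simp
      then have "pt t v = - (?A * (inverse \<zeta> * \<omega> ^ j) + ?B * \<omega> ^ j)"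
        unfolding eq_neg_iff_add_eq_0 using i
        by (simp only: t pt_def prod.case idx) (simp add: algebra_simps)
      then have pt: "PConst (pt t v) = - (PConst ?A * PConst (inverse \<zeta> * \<omega> ^ j) + PConst ?B * PConst (\<omega> ^ j))"
        by (simp only: PConst_uminus PConst_add PConst_mult)
      have "L t * (PVar v + PConst ?A * PVar y + PConst ?B * PVar x)
        - (PConst ?A * ((PVar y - PConst (inverse \<zeta> * \<omega> ^ j)) * L t)
           + PConst ?B * ((PVar x - PConst (\<omega> ^ j)) * L t)) \<in> I"
        unfolding t i(2) using L_carrier
        by (intro mpoly_ideal_diff[OF I] mpoly_ideal_add[OF I] mpoly_ideal_mult[OF I _ gen[OF 3]]
            mpoly_ideal_mult[OF I _ ev_x] mpoly_ideal_mult[OF I _ ev_y[OF \<zeta>]]) simp_all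
      also have "L t * (PVar v + PConst ?A * PVar y + PConst ?B * PVar x)
        - (PConst ?A * ((PVar y - PConst (inverse \<zeta> * \<omega> ^ j)) * L t)
           + PConst ?B * ((PVar x - PConst (\<omega> ^ j)) * L t)) = (PVar v - PConst (pt t v)) * L t"
        unfolding pt by (simp add: algebra_simps)
      finally show ?thesis .
    qed
  next
    fix t assume "t \<in> T"
    then obtain \<zeta> j where t: "t = (\<zeta>, j)" and \<zeta>: "\<zeta> = \<omega> \<or> \<zeta> = inverse \<omega>"
      by (auto simp: T_def)
    show "peval (pt t) f = 0"
      using unit[of j] \<zeta> by (rule f(2)) (simp add: pt_def t idx)
  qed (simp_all add: L_carrier f)
  then show ?thesis by (simp add: I_def)
qed

text \<open>The points run over the full grid of roots of unity, and the idempotents are products of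
  one-variable ones. Nothing about the zeros of \<open>I\<close> has to be known in advance, which
  suits the Hamiltonian ideal.\<close>

lemma mem_ideal_if_vanishes_on_grid_zeros:
  fixes \<omega> :: "'k::field" and V :: "'v set" and f :: "('v, 'k) mpoly"
  assumes \<omega>: "primitive_root_of_unity n \<omega>" and n: "of_nat n \<noteq> (0::'k)" and V: "finite V"
    and I: "ideal I (mpoly_ring V)" and pow: "\<And>v. v \<in> V \<Longrightarrow> PVar v ^ n - 1 \<in> I"
    and f: "f \<in> carrier (mpoly_ring V)"
      "\<And>a. (\<And>g. g \<in> I \<Longrightarrow> peval a g = 0) \<Longrightarrow> peval a f = 0"
  shows "f \<in> I"
proof (rule mem_ideal_if_vanishes_on_zeros[OF I, of "V \<rightarrow>\<^sub>E {..<n}" "\<lambda>t. \<Prod>v\<in>V. lagrange_idem \<omega> n (t v) v"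
      "\<lambda>t v. \<omega> ^ t v"])
  show "(\<Sum>t\<in>V \<rightarrow>\<^sub>E {..<n}. \<Prod>v\<in>V. lagrange_idem \<omega> n (t v) v) = 1"
    \<comment> \<open>Expanding the product over \<open>V\<close> of the one-variable sums, each
      equal to 1, gives the sum over the grid.\<close>
    using V by (subst prod_sum_PiE[symmetric]) (simp_all add: sum_lagrange_idem[OF \<omega> n])
  fix t :: "'v \<Rightarrow> nat" and v assume v: "v \<in> V"
  have "(\<Prod>u\<in>V - {v}. lagrange_idem \<omega> n (t u) u) * PConst (\<omega> ^ t v / of_nat n) * (PVar v ^ n - 1) \<in> I"
    using pow[OF v] by (intro mpoly_ideal_mult[OF I] mult_in_mpoly_ring prod_in_mpoly_ring) simp_all
  also have "(\<Prod>u\<in>V - {v}. lagrange_idem \<omega> n (t u) u) * PConst (\<omega> ^ t v / of_nat n) * (PVar v ^ n - 1)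
      = (PVar v - PConst (\<omega> ^ t v)) * (\<Prod>u\<in>V. lagrange_idem \<omega> n (t u) u)"
    unfolding mult.assoc lagrange_idem_mult[OF \<omega>, symmetric] prod.remove[OF V v]
    by (simp add: ac_simps)
  finally show "(PVar v - PConst (\<omega> ^ t v)) * (\<Prod>u\<in>V. lagrange_idem \<omega> n (t u) u) \<in> I" .
qed (use f in \<open>auto intro!: prod_in_mpoly_ring\<close>)

section \<open>Hamiltonian cycles\<close>

text \<open>Values along the walk are \<open>\<omega>^i\<close> times the start value, so the first
  \<open>n\<close> vertices are distinct and exhaust the graph by counting. Step \<open>n\<close>
  then meets one of them again, and comparing values shows that it is the start.\<close>

lemma hamiltonian_cycle_of_point:
  fixes \<omega> :: "'k::field"
  assumes wf: "pair_fin_digraph G" and n: "card (pverts G) = n" "2 < n"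
    and \<omega>: "primitive_root_of_unity n \<omega>"
    and a: "\<And>v. v \<in> pverts G \<Longrightarrow> a v \<noteq> 0"
      "\<And>v. v \<in> pverts G \<Longrightarrow> \<exists>w\<in>out_nbrs G v. a w = \<omega> * a v"
  obtains C where "C \<in> hamiltonian_cycles G" "\<And>u v. (u, v) \<in> C \<Longrightarrow> a v = \<omega> * a u"
proof -
  interpret pair_fin_digraph G by (rule wf)
  obtain s where s: "\<And>v. v \<in> pverts G \<Longrightarrow> (v, s v) \<in> parcs G \<and> a (s v) = \<omega> * a v"
    using a(2) unfolding out_nbrs_def by (metis mem_Collect_eq)
  obtain v0 where v0: "v0 \<in> pverts G"
    using n by fastforce
  define w where "w i = (s ^^ i) v0" for i
  have w_in: "w i \<in> pverts G" for i
    by (induction i) (use s v0 in \<open>auto simp: w_def dest: in_arcsD2\<close>)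
  have w_Suc: "(w i, w (Suc i)) \<in> parcs G" "a (w (Suc i)) = \<omega> * a (w i)" for i
    using s[OF w_in[of i]] by (simp_all add: w_def)
  have aw: "a (w i) = \<omega> ^ i * a v0" for i
    by (induction i) (simp_all add: w_Suc(2), simp add: w_def)
  have inj: "i = j" if "w i = w j" "i < n" "j < n" for i j
    using aw[of i] aw[of j] that a(1)[OF v0] by (auto intro: primitive_root_inj[OF \<omega>])
  have "card (w ` {..<n}) = n"
    using inj by (subst card_image) (auto simp: inj_on_def)
  then have "w ` {..<n} = pverts G"
    using w_in n pair_finite_verts by (intro card_subset_eq) auto
  then obtain i where i: "i < n" "w n = w i"
    using w_in[of n] by auto
  have "\<omega> ^ i = \<omega> ^ 0"
    using aw[of i] aw[of n] i(2) a(1)[OF v0] \<omega> by (auto simp: primitive_root_of_unity_def)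
  then have "i = 0"
    using i n by (intro primitive_root_inj[OF \<omega>]) auto
  \<comment> \<open>Closing up makes the successor index modulo \<open>n\<close> agree with the
    plain successor.\<close>
  then have wn: "w (Suc i mod n) = w (Suc i)" if "i < n" for i
    using that i by (cases "Suc i = n") auto
  define vs where "vs = map w [0..<n]"
  have "vs ! i = w i \<and> vs ! (Suc i mod n) = w (Suc i)" if "i < n" for i
    using wn[OF that] that by (simp add: vs_def)
  then have arcs: "cycle_arcs vs = {(w i, w (Suc i)) | i. i < n}"
    by (simp add: cycle_arcs_def vs_def cong: rev_conj_cong)
  have "distinct vs"
    using inj by (auto simp: vs_def distinct_map inj_on_def)
  then have "cycle_listing G (cycle_arcs vs) vs"
    using n w_Suc(1) by (auto simp: cycle_listing_def arcs) (simp add: vs_def)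
  then have "cycle_arcs vs \<in> hamiltonian_cycles G"
    using n by (auto simp: hamiltonian_cycles_def vs_def)
  moreover have "a v = \<omega> * a u" if "(u, v) \<in> cycle_arcs vs" for u v
    using that w_Suc(2) by (auto simp: arcs)
  ultimately show ?thesis
    using that by blast
qed

section \<open>Listings of a Hamiltonian cycle and the values along it\<close>

lemma cycle_arc_nth: "i < length vs \<Longrightarrow> (vs ! i, vs ! (Suc i mod length vs)) \<in> cycle_arcs vs"
  by (auto simp: cycle_arcs_def)

text \<open>The tails of the arcs are distinct. The length of a listing can therefore be read off
  from the arc set alone.\<close>

lemma card_cycle_arcs:
  assumes "distinct vs"
  shows "card (cycle_arcs vs) = length vs"
proof -
  have "cycle_arcs vs = (\<lambda>i. (vs ! i, vs ! (Suc i mod length vs))) ` {..<length vs}"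
    by (auto simp: cycle_arcs_def)
  then show ?thesis
    using assms by (simp add: card_image inj_on_def nth_eq_iff_index_eq)
qed

text \<open>Membership in \<open>hamiltonian_cycles\<close> only provides some listing of full
  length; the given one is equally long because both lengths count the arcs of
  \<open>C\<close>.\<close>

lemma hamiltonian_listing:
  assumes wf: "pair_fin_digraph G" and C: "C \<in> hamiltonian_cycles G" "cycle_listing G C vs"
  shows "length vs = card (pverts G)" "set vs = pverts G"
proof -
  interpret pair_fin_digraph G by (rule wf)
  obtain us where "cycle_listing G C us" "length us = card (pverts G)"
    using C(1) by (auto simp: hamiltonian_cycles_def)
  then show len: "length vs = card (pverts G)"
    using C(2) card_cycle_arcs[of vs] card_cycle_arcs[of us] by (simp add: cycle_listing_def)
  have "set vs \<subseteq> pverts G"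
  proof
    fix v assume "v \<in> set vs"
    then obtain i where i: "i < length vs" "v = vs ! i"
      by (metis in_set_conv_nth)
    have "(v, vs ! (Suc i mod length vs)) \<in> parcs G"
      using C(2) cycle_arc_nth[OF i(1)] unfolding i(2) cycle_listing_def by blast
    then show "v \<in> pverts G"
      by (rule in_arcsD1)
  qed
  moreover have "card (set vs) = card (pverts G)"
    using C(2) len by (simp add: cycle_listing_def distinct_card)
  ultimately show "set vs = pverts G"
    using pair_finite_verts by (simp add: card_subset_eq)
qed

lemma power_power_commute: "(x ^ i) ^ j = (x ^ j) ^ (i::nat)" for x :: "'a::monoid_mult"
  by (simp add: mult.commute flip: power_mult)

lemma geometric_along_cycle:
  fixes a :: "'v \<Rightarrow> 'k::field"
  assumes "\<And>u v. (u, v) \<in> cycle_arcs vs \<Longrightarrow> a v = \<omega> * a u" "i < length vs"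
  shows "a (vs ! i) = \<omega> ^ Suc i * a (vs ! (length vs - 1))"
  using assms(2)
proof (induction i)
  \<comment> \<open>The closing arc leads from the last vertex to \<open>vs ! 0\<close>.\<close>
  case 0
  then show ?case
    using assms(1)[OF cycle_arc_nth[of "length vs - 1"]] by simp
next
  case (Suc i)
  then show ?case
    using assms(1)[OF cycle_arc_nth[of i]] by simp
qed

text \<open>A product in a field vanishes exactly if a factor does. A vertex without out-neighbours
  gives the generator 1, in agreement with the empty existential; finiteness matters because an
  infinite product is 1 by default.\<close>

lemma peval_hamiltonian_gen_eq_0_iff:
  assumes fin: "finite (out_nbrs G v)"
  shows "peval a (\<Prod>w\<in>out_nbrs G v. PConst \<omega> * PVar v - PVar w) = 0
    \<longleftrightarrow> (\<exists>w\<in>out_nbrs G v. a w = \<omega> * a v)"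
  using fin by (simp add: peval_prod) metis

text \<open>Since \<open>listing\<close> is arbitrary, the equality covers every choice of starting
  vertices. Intersecting with the carrier turns the intersection over no cycles into the whole
  ring.\<close>

theorem theorem3p9:
  fixes G :: "nat pair_pre_digraph"
    and n :: nat
    and \<omega> :: "'k::alg_closed_field"
    and listing :: "(nat \<times> nat) set \<Rightarrow> nat list"
  assumes "pair_digraph G"
    and "pverts G = {1..n}"
    and "connected (with_proj G)"
    and "n \<ge> 3"
    and "\<not> CHAR('k) dvd n"
    and "primitive_root_of_unity n \<omega>"
    and "\<And>C. C \<in> hamiltonian_cycles G \<Longrightarrow> cycle_listing G C (listing C)"
  shows "hamiltonian_ideal G \<omega> =
    carrier (mpoly_ring {1..n}) \<inter> (\<Inter>C \<in> hamiltonian_cycles G. cycle_ideal G \<omega> (listing C))"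
proof -
  have wf: "pair_fin_digraph G"
    using assms(1) by (simp add: pair_digraph_def)
  interpret pair_fin_digraph G by (rule wf)
  note \<omega> = assms(6)
  have n: "of_nat n \<noteq> (0::'k)"
    using assms(5) by (simp add: of_nat_eq_0_iff_char_dvd)
  define V where "V = {1..n}"
  have V: "pverts G = V" "finite V" "card V = n"
    using assms(2) by (simp_all add: V_def)
  have out: "out_nbrs G v \<subseteq> V" for v
    using in_arcsD2 V(1) by (auto simp: out_nbrs_def)
  then have fin_out: "finite (out_nbrs G v)" for v
    using V(2) by (rule finite_subset)
  define S :: "(nat, 'k) mpoly set" where "S = (\<lambda>v. PVar v ^ n - 1) ` V \<union>
    (\<lambda>v. \<Prod>w\<in>out_nbrs G v. PConst \<omega> * PVar v - PVar w) ` V"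
  have S: "S \<subseteq> carrier (mpoly_ring V)"
    using out[THEN subsetD] unfolding S_def
    by (auto intro!: prod_in_mpoly_ring diff_in_mpoly_ring mult_in_mpoly_ring)
  define H where "H = hamiltonian_ideal G \<omega>"
  have H_eq: "H = Idl\<^bsub>mpoly_ring V\<^esub> S"
    by (simp add: H_def hamiltonian_ideal_def S_def V)
  have H: "ideal H (mpoly_ring V)"
    unfolding H_eq by (rule ideal_Idl_mpoly_ring[OF S])
  have gen_H: "g \<in> H" if "g \<in> S" for g
    unfolding H_eq using S that by (rule Idl_mpoly_ring_self)
  have listing: "cycle_listing G C (listing C)" "length (listing C) = n" "set (listing C) = V"
    "C = cycle_arcs (listing C)" "distinct (listing C)" "2 < length (listing C)"
    if "C \<in> hamiltonian_cycles G" for C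
    using assms(7)[OF that] hamiltonian_listing[OF wf that assms(7)[OF that]] V
    by (auto simp: cycle_listing_def)

  \<comment> \<open>First inclusion: the generators of \<open>H\<close> vanish at all the points
    that decide membership in the cycle ideal.\<close>
  have "H \<subseteq> cycle_ideal G \<omega> (listing C)" if C: "C \<in> hamiltonian_cycles G" for C
  proof -
    define vs where "vs = listing C"
    note L = listing[OF C, folded vs_def]
    have vs: "primitive_root_of_unity (length vs) \<omega>" "of_nat (length vs) \<noteq> (0::'k)"
      using \<omega> n by (simp_all add: L(2))
    have arc: "vs ! (Suc i mod n) \<in> out_nbrs G (vs ! i)" if "i < n" for i
      using cycle_arc_nth[of i vs] that L(1,2) by (auto simp: out_nbrs_def cycle_listing_def)
    have pow_vanish: "(\<zeta> ^ i * c) ^ n = 1" if "c ^ n = 1" "\<zeta> ^ n = 1" for \<zeta> c :: 'k and i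
      using that by (simp add: power_mult_distrib power_power_commute[of \<zeta> i n])
    have \<omega>n: "\<omega> ^ n = 1" "inverse \<omega> ^ n = 1"
      using \<omega> by (auto simp: primitive_root_of_unity_def power_inverse)
    \<comment> \<open>The wrap-around from position \<open>n - 1\<close> to 0 changes the exponent
      by \<open>n\<close>, which is harmless as \<open>\<zeta>^n = 1\<close>.\<close>
    have next_index: "\<zeta> ^ Suc (Suc i mod n) = \<zeta> ^ Suc (Suc i)" if "\<zeta> ^ n = 1" "i < n" for \<zeta> :: 'k and i
      using that by (cases "Suc i = n") auto
    \<comment> \<open>The neighbour condition \<open>nbr\<close> stays a hypothesis, so that both
      orientations share this step.\<close>
    have vanish: "peval a g = 0" if "g \<in> S" and c: "c ^ n = 1" "\<zeta> ^ n = 1"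
      and a: "\<And>i. i < n \<Longrightarrow> a (vs ! i) = \<zeta> ^ Suc i * c"
      and nbr: "\<And>i. i < n \<Longrightarrow> \<exists>w\<in>out_nbrs G (vs ! i). a w = \<omega> * a (vs ! i)" for a g c \<zeta>
    proof -
      have pow1: "a v ^ n = 1" and nbr1: "\<exists>w\<in>out_nbrs G v. a w = \<omega> * a v" if "v \<in> V" for v
        using that L(2,3) a nbr pow_vanish[OF c] by (metis in_set_conv_nth)+
      show ?thesis
        using \<open>g \<in> S\<close> unfolding S_def
        by (auto simp: pow1 nbr1 peval_hamiltonian_gen_eq_0_iff[OF fin_out])
    qed
    have forward: "\<exists>w\<in>out_nbrs G (vs ! i). a w = \<omega> * a (vs ! i)"
      if a: "\<And>i. i < n \<Longrightarrow> a (vs ! i) = \<omega> ^ Suc i * c" and i: "i < n" for a c i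
    proof
      show "a (vs ! (Suc i mod n)) = \<omega> * a (vs ! i)"
        using a[of "Suc i mod n"] a[of i] i unfolding next_index[OF \<omega>n(1) i] by simp
    qed (rule arc[OF i])
    have "g \<in> cycle_ideal G \<omega> vs" if g: "g \<in> S" for g
    proof (cases "doubly_covered G (cycle_arcs vs)")
      case False
      show ?thesis
      proof (rule mem_directed_cycle_ideal[OF vs(1) L(6) vs(2) L(5) False])
        show "peval a g = 0" if "c ^ length vs = 1"
          "\<And>i. i < length vs \<Longrightarrow> a (vs ! i) = \<omega> ^ Suc i * c" for a c
          using that forward[of a c] unfolding L(2) by (intro vanish[OF g _ \<omega>n(1), of c a]) blast+
      qed (use S g in \<open>unfold L(3), blast\<close>)
    next
      case True
      show ?thesis
      proof (rule mem_doubly_covered_cycle_ideal[OF vs(1) L(6) vs(2) L(5) True])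
        fix a c \<zeta> assume c: "c ^ length vs = 1" and \<zeta>: "\<zeta> = \<omega> \<or> \<zeta> = inverse \<omega>"
          and a: "\<And>i. i < length vs \<Longrightarrow> a (vs ! i) = \<zeta> ^ Suc i * c"
        note a = a[unfolded L(2)]
        have "\<exists>w\<in>out_nbrs G (vs ! i). a w = \<omega> * a (vs ! i)" if i: "i < n" for i
        proof (cases "\<zeta> = \<omega>")
          case True
          then show ?thesis using forward a i by blast
        next
          case False
          then have \<zeta>: "\<zeta> = inverse \<omega>" using \<zeta> by simp
          \<comment> \<open>In the reversed orientation the cyclic predecessor \<open>j\<close> of
            \<open>i\<close> carries \<omega> times the value; the arc to it exists because the
            cycle is doubly covered.\<close>
          define j where "j = (if i = 0 then n - 1 else i - 1)"
          have j: "j < n" "Suc j mod n = i"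
            using i by (auto simp: j_def)
          have "(vs ! j, vs ! i) \<in> cycle_arcs vs"
            using cycle_arc_nth[of j vs] j L(2) by simp
          then have "vs ! j \<in> out_nbrs G (vs ! i)"
            using True by (auto simp: doubly_covered_def out_nbrs_def)
          moreover have "\<zeta> ^ Suc i = \<zeta> ^ Suc (Suc j)"
            using next_index[OF _ j(1), of \<zeta>] \<omega>n(2) unfolding j(2) \<zeta> by blast
          then have "a (vs ! i) = \<zeta> * a (vs ! j)"
            unfolding a[OF j(1)] a[OF i] by (simp only: power_Suc mult.assoc)
          then have "a (vs ! j) = \<omega> * a (vs ! i)"
            using primitive_root_nonzero[OF \<omega>] by (simp add: \<zeta>)
          ultimately show ?thesis by blast
        qed
        then show "peval a g = 0"
          using c \<zeta> \<omega>n a unfolding L(2) by (intro vanish[OF g, of c \<zeta> a]) blast+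
      qed (use S g in \<open>unfold L(3), blast\<close>)
    qed
    then have "S \<subseteq> cycle_ideal G \<omega> vs" by blast
    then show ?thesis
      using ideal_cycle_ideal[OF L(6), of G \<omega>] unfolding H_eq vs_def[symmetric] L(3)
      by (intro Idl_mpoly_ring_minimal)
  qed
  moreover have "H \<subseteq> carrier (mpoly_ring V)"
    using ideal_subset_mpoly_ring[OF H] by blast
  \<comment> \<open>Second inclusion: a zero of \<open>H\<close> traces out a Hamiltonian cycle, and
    \<open>f\<close> vanishes there because it lies in the ideal of that cycle.\<close>
  moreover have "f \<in> H" if f: "f \<in> carrier (mpoly_ring V)"
    "\<And>C. C \<in> hamiltonian_cycles G \<Longrightarrow> f \<in> cycle_ideal G \<omega> (listing C)" for f
  proof (rule mem_ideal_if_vanishes_on_grid_zeros[OF \<omega> n V(2) H _ f(1)])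
    show "PVar v ^ n - 1 \<in> H" if "v \<in> V" for v
      using that by (intro gen_H) (simp add: S_def)
    fix a assume a: "\<And>g. g \<in> H \<Longrightarrow> peval a g = 0"
    have pow: "a v ^ n = 1" if "v \<in> V" for v
    proof -
      have "PVar v ^ n - 1 \<in> S"
        unfolding S_def using that by blast
      from a[OF gen_H[OF this]] show ?thesis
        by simp
    qed
    have nbr: "\<exists>w\<in>out_nbrs G v. a w = \<omega> * a v" if "v \<in> V" for v
    proof -
      have "(\<Prod>w\<in>out_nbrs G v. PConst \<omega> * PVar v - PVar w) \<in> S"
        unfolding S_def using that by blast
      from a[OF gen_H[OF this]] show ?thesis
        by (simp only: peval_hamiltonian_gen_eq_0_iff[OF fin_out])
    qed
    have "a v \<noteq> 0" if "v \<in> V" for v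
      using pow[OF that] assms(4) by (auto simp: power_0_left split: if_splits)
    then obtain C where C: "C \<in> hamiltonian_cycles G" "\<And>u v. (u, v) \<in> C \<Longrightarrow> a v = \<omega> * a u"
      using hamiltonian_cycle_of_point[OF wf _ _ \<omega>, of a] V nbr assms(4)
      by (metis less_le_trans lessI numeral_3_eq_3 numeral_2_eq_2)
    define vs where "vs = listing C"
    note L = listing[OF C(1), folded vs_def]
    show "peval a f = 0"
    proof (rule peval_cycle_ideal[OF _ L(6)])
      show "f \<in> cycle_ideal G \<omega> vs"
        using f(2)[OF C(1)] by (simp add: vs_def)
      \<comment> \<open>The constant \<open>c\<close> is the value at the last vertex of the
        listing.\<close>
      show "a (vs ! (length vs - 1)) ^ length vs = 1"
        unfolding L(2) using L(2,3,6) by (intro pow) (metis diff_less gr_zeroI less_nat_zero_code nth_mem zero_less_one)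
      show "a (vs ! i) = \<omega> ^ Suc i * a (vs ! (length vs - 1))" if "i < length vs" for i
        using C(2) that unfolding L(4) by (rule geometric_along_cycle)
    qed (use \<omega> in \<open>simp only: L(2)\<close>)
  qed
  ultimately show ?thesis
    unfolding H_def[symmetric] V_def[symmetric] by blast
qed

end
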